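(* Let $\Pi$ be a set of Cayley permutations. Then there exists a positive integer $k$ with $\mathcal{D}(\Pi) \subseteq \mathcal{SBM}_H(k)$ if and only if $\mathcal{D}(\Pi)$ avoids a Cayley permutation from each of $\mathcal{H}_{I,I}$ and $\mathcal{H}_{I,D}$; that is, if and only if there exist $\sigma \in \mathcal{H}_{I,I}$ and $\tau \in \mathcal{H}_{I,D}$ such that every element of $\mathcal{D}(\Pi)$ avoids both $\sigma$ and $\tau$.
   Context: A Cayley permutation is a finite word $\pi = \pi_1\pi_2\cdots\pi_n$ of positive integers in which every value between $1$ and the maximum value of $\pi$ appears at least once; its size is $n$ and its height is its maximum value. A restricted growth function (RGF) is a Cayley permutation in which, for every value $v$ occurring and every $1 \le u < v$, the first occurrence of $u$ is to the left of the first occurrence of $v$. An RGF of a (perfect) matching is an RGF in which every value that occurs, occurs exactly twice. The standardisation of a word of positive integers is the Cayley permutation obtained by replacing all occurrences of the smallest value by $1$, of the next smallest value by $2$, and so on. A Cayley permutation $\pi$ contains a Cayley permutation $\sigma$ if some (not necessarily contiguous) subsequence of $\pi$ standardises to $\sigma$; otherwise $\pi$ avoids $\sigma$. For a set $\Pi$ of Cayley permutations, $\mathcal{D}(\Pi)$ is the set of all RGFs of matchings that avoid every element of $\Pi$. Horizontal juxtapositions: a Cayley permutation $\pi$ of size $n+m$ is a horizontal juxtaposition of a Cayley permutation $\sigma$ of size $n$ and a Cayley permutation $\tau$ of size $m$ if the first $n$ entries of $\pi$ standardise to $\sigma$ and the last $m$ entries standardise to $\tau$. $\mathcal{H}_{I,I}$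 is the set of Cayley permutations that are horizontal juxtapositions of a strictly increasing sequence and a strictly increasing sequence; $\mathcal{H}_{I,D}$ is the set of those that are horizontal juxtapositions of a strictly increasing sequence (on the left) and a strictly decreasing sequence (on the right). Horizontal evolution: a Cayley permutation $\pi = \pi_1\cdots\pi_n$ is built by inserting its entries from left to right. For $0 \le t \le n$, the configuration after $t$ insertions consists of the standardisation of $\pi_1\cdots\pi_t$ together with slots: (i) one repeating slot $\overline{\diamond}$ at the height of each value $v$ that occurs in $\pi_1\cdots\pi_t$ and also occurs in $\pi_{t+1}\cdots\pi_n$; and (ii) one new slot $\diamond$ in each gap (below the smallest value of $\pi_1\cdots\pi_t$, strictly between two consecutive distinct values of $\pi_1\cdots\pi_t$, or above the largest; for $t=0$ there is a single gap) that contains at least one value occurring in $\pi_{t+1}\cdots\pi_n$. The horizontal evolution of $\pi$ is the sequence of these configurations. $\mathcal{SBM}_H(k)$ is the set of all RGFs of matchings such that every configuration in their horizontal evolution has at most $k$ slots in total (new and repeating slots are both counted). *)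

theory Defs
  imports Main "HOL-Library.Sublist"
begin

text \<open>
  Words are lists of natural numbers, with list positions counted from 0. The values of a Cayley
  permutation are positive. The empty word is a Cayley permutation, of size and height 0.
\<close>

definition height :: "nat list \<Rightarrow> nat" where
  "height w = (if w = [] then 0 else Max (set w))"

definition cayley :: "nat list \<Rightarrow> bool" where
  "cayley w \<longleftrightarrow> (\<forall>v\<in>set w. 1 \<le> v) \<and> (\<forall>v\<in>{1..height w}. v \<in> set w)"

text \<open>Only meaningful for values \<open>v\<close> that occur in \<open>w\<close>.\<close>

definition first_occurrence :: "nat list \<Rightarrow> nat \<Rightarrow> nat" where
  "first_occurrence w v = (LEAST i. i < length w \<and> w ! i = v)"

definition rgf :: "nat list \<Rightarrow> bool" where
  "rgf w \<longleftrightarrow> cayley w \<and>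
     (\<forall>v\<in>set w. \<forall>u. 1 \<le> u \<and> u < v \<longrightarrow> first_occurrence w u < first_occurrence w v)"

definition matching_rgf :: "nat list \<Rightarrow> bool" where
  "matching_rgf w \<longleftrightarrow> rgf w \<and> (\<forall>v\<in>set w. count_list w v = 2)"

definition standardise :: "nat list \<Rightarrow> nat list" where
  "standardise w = map (\<lambda>x. card {y \<in> set w. y \<le> x}) w"

text \<open>The relation \<open>subseq\<close> is the library's not necessarily contiguous subsequence relation.\<close>

definition contains :: "nat list \<Rightarrow> nat list \<Rightarrow> bool" where
  "contains p s \<longleftrightarrow> (\<exists>w. subseq w p \<and> standardise w = s)"

definition avoids :: "nat list \<Rightarrow> nat list \<Rightarrow> bool" where
  "avoids p s \<longleftrightarrow> \<not> contains p s"

definition matching_class :: "nat list set \<Rightarrow> nat list set" where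
  "matching_class Pats = {p. matching_rgf p \<and> (\<forall>s\<in>Pats. avoids p s)}"

definition horizontal_juxtaposition :: "nat list \<Rightarrow> nat list \<Rightarrow> nat list \<Rightarrow> bool" where
  "horizontal_juxtaposition p s t \<longleftrightarrow>
     cayley p \<and> cayley s \<and> cayley t \<and> length p = length s + length t \<and>
     standardise (take (length s) p) = s \<and> standardise (drop (length s) p) = t"

definition H_II :: "nat list set" where
  "H_II = {p. \<exists>s t. sorted_wrt (<) s \<and> sorted_wrt (<) t \<and> horizontal_juxtaposition p s t}"

definition H_ID :: "nat list set" where
  "H_ID = {p. \<exists>s t. sorted_wrt (<) s \<and> sorted_wrt (>) t \<and> horizontal_juxtaposition p s t}"

text \<open>
  Slots are positioned relative to the standardisation of the inserted prefix, whose values are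
  \<open>1, \<dots>, h\<close>: \<open>Repeating i\<close> is the repeating slot at the height of the value \<open>i\<close>, and
  \<open>New i\<close>, for \<open>0 \<le> i \<le> h\<close>, is the new slot in the gap having exactly the values
  \<open>1, \<dots>, i\<close> below it. In the original prefix that gap consists of those values, not
  occurring in the prefix, that exceed exactly \<open>i\<close> of the distinct values of the prefix.
\<close>

datatype slot = Repeating nat | New nat

definition gap :: "nat list \<Rightarrow> nat \<Rightarrow> nat set" where
  "gap w i = {v. 1 \<le> v \<and> v \<notin> set w \<and> card {u \<in> set w. u < v} = i}"

definition repeating_slots :: "nat list \<Rightarrow> nat \<Rightarrow> slot set" where
  "repeating_slots p t =
     (\<lambda>v. Repeating (card {u \<in> set (take t p). u \<le> v})) ` (set (take t p) \<inter> set (drop t p))"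

definition new_slots :: "nat list \<Rightarrow> nat \<Rightarrow> slot set" where
  "new_slots p t =
     New ` {i \<in> {0..card (set (take t p))}. gap (take t p) i \<inter> set (drop t p) \<noteq> {}}"

definition configuration :: "nat list \<Rightarrow> nat \<Rightarrow> nat list \<times> slot set" where
  "configuration p t = (standardise (take t p), repeating_slots p t \<union> new_slots p t)"

definition horizontal_evolution :: "nat list \<Rightarrow> (nat list \<times> slot set) list" where
  "horizontal_evolution p = map (configuration p) [0..<Suc (length p)]"

definition SBM_H :: "nat \<Rightarrow> nat list set" where
  "SBM_H k = {p. matching_rgf p \<and> (\<forall>(w, slots)\<in>set (horizontal_evolution p). card slots \<le> k)}"

end

theory Submission
  imports Defs "HOL-Library.Ramsey"
begin

text \<open>
  In a restricted growth function the values seen so far are always the smallest ones, so a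
  configuration has at most one new slot: the one above the maximum (\<open>card_new_slots_rgf\<close>).
  Bounding the slots therefore amounts to bounding the repeating slots, which are in bijection with
  the values shared by a prefix and the remaining suffix (\<open>card_repeating_slots\<close>).

  The prefix reads any set of shared values in increasing order, because first occurrences are
  increasing. The order in the suffix is arbitrary, but Ramsey's theorem for pairs extracts from many
  shared values a large set that the suffix reads monotonically
  (\<open>many_shared_values_imp_double_run\<close>). So many repeating slots force one of the double runs
  \<open>1 \<dots> n 1 \<dots> n\<close> and \<open>1 \<dots> n n \<dots> 1\<close> with \<open>n\<close> large, while either double run in
  turn forces \<open>n\<close> repeating slots (\<open>contains_imp_many_shared_values\<close>).

  Finally, the double runs are cofinal for containment in the two classes of juxtapositions: they
  belong to \<open>H_II\<close> and \<open>H_ID\<close> respectively, and every member of height at most \<open>n\<close> of either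
  class is contained in the corresponding double run (\<open>H_II_subseq\<close>, \<open>H_ID_subseq\<close>). Hence a
  set of words avoids some member of a class if and only if it avoids one of the double runs in it.
\<close>

section \<open>Standardisation\<close>

lemma set_cayley:
  assumes "cayley w"
  shows "set w = {1..height w}"
proof
  show "set w \<subseteq> {1..height w}"
  proof
    fix v assume v: "v \<in> set w"
    then have "v \<le> height w" by (cases w) (simp_all add: height_def)
    moreover have "1 \<le> v" using v assms unfolding cayley_def by blast
    ultimately show "v \<in> {1..height w}" by simp
  qed
  show "{1..height w} \<subseteq> set w"
    using assms unfolding cayley_def by blast
qed

lemma standardise_initial_interval:
  assumes "set w = {1..m}"
  shows "standardise w = w"
proof -
  have "card {y \<in> set w. y \<le> x} = x" if "x \<in> set w" for x
  proof -
    have "{y \<in> set w. y \<le> x} = {1..x}" using that assms by auto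
    then show ?thesis by simp
  qed
  then show ?thesis
    unfolding standardise_def by (rule map_idI)
qed

lemma cayley_initial_interval:
  assumes "set w = {1..m}"
  shows "cayley w"
proof (cases "w = []")
  case True
  then show ?thesis by (simp add: cayley_def height_def)
next
  case False
  then have "1 \<le> m" using assms by (cases m) auto
  then have "height w = m" using False assms by (auto simp: height_def intro: Max_eqI)
  then show ?thesis using assms by (simp add: cayley_def)
qed

lemma standardise_map_strict_mono:
  assumes "strict_mono_on (set w) f"
  shows "standardise (map f w) = standardise w"
proof -
  have "card {y \<in> set (map f w). y \<le> f x} = card {y \<in> set w. y \<le> x}" if "x \<in> set w" for x
  proof -
    have eq: "{y \<in> set (map f w). y \<le> f x} = f ` {y \<in> set w. y \<le> x}"
      using strict_mono_on_less_eq[OF assms _ that] by auto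
    have "inj_on f {y \<in> set w. y \<le> x}"
      by (rule inj_on_subset[OF strict_mono_on_imp_inj_on[OF assms]]) auto
    then show ?thesis unfolding eq by (rule card_image)
  qed
  then show ?thesis by (simp add: standardise_def)
qed

lemma card_le_less_imp_less:
  fixes x y :: nat
  assumes "finite A" "card {a \<in> A. a \<le> x} < card {a \<in> A. a \<le> y}"
  shows "x < y"
proof (rule ccontr)
  assume "\<not> x < y"
  then have "card {a \<in> A. a \<le> y} \<le> card {a \<in> A. a \<le> x}"
    using assms(1) by (intro card_mono) auto
  with assms(2) show False by simp
qed

lemma inj_on_card_le:
  fixes A :: "nat set"
  assumes "finite A"
  shows "inj_on (\<lambda>x. card {a \<in> A. a \<le> x}) A"
proof (rule linorder_inj_onI')
  fix x y assume "x \<in> A" "y \<in> A" "x < y"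
  then have "y \<in> {a \<in> A. a \<le> y} - {a \<in> A. a \<le> x}" by simp
  moreover have "{a \<in> A. a \<le> x} \<subseteq> {a \<in> A. a \<le> y}" using \<open>x < y\<close> by auto
  ultimately have "{a \<in> A. a \<le> x} \<subset> {a \<in> A. a \<le> y}" by blast
  then have "card {a \<in> A. a \<le> x} < card {a \<in> A. a \<le> y}"
    using assms by (intro psubset_card_mono) auto
  then show "card {a \<in> A. a \<le> x} \<noteq> card {a \<in> A. a \<le> y}" by simp
qed

lemma sorted_standardiseD:
  assumes "sorted_wrt (<) (standardise w)"
  shows "sorted_wrt (<) w"
  using assms unfolding standardise_def sorted_wrt_map
  by (rule sorted_wrt_mono_rel[rotated]) (blast intro: card_le_less_imp_less)

lemma sorted_desc_standardiseD:
  assumes "sorted_wrt (>) (standardise w)"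
  shows "sorted_wrt (>) w"
  using assms unfolding standardise_def sorted_wrt_map
  by (rule sorted_wrt_mono_rel[rotated]) (blast intro: card_le_less_imp_less)

section \<open>Cofinal families of juxtapositions\<close>

lemma H_II_double_run: "[1..<Suc m] @ [1..<Suc m] \<in> H_II"
proof -
  have "horizontal_juxtaposition ([1..<Suc m] @ [1..<Suc m]) [1..<Suc m] [1..<Suc m]"
    unfolding horizontal_juxtaposition_def
    by (auto intro!: cayley_initial_interval[of _ m] standardise_initial_interval[of _ m]
        simp del: upt_Suc)
  then show ?thesis unfolding H_II_def using sorted_wrt_upt by blast
qed

lemma H_ID_double_run: "[1..<Suc m] @ rev [1..<Suc m] \<in> H_ID"
proof -
  have "horizontal_juxtaposition ([1..<Suc m] @ rev [1..<Suc m]) [1..<Suc m] (rev [1..<Suc m])"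
    unfolding horizontal_juxtaposition_def
    by (auto intro!: cayley_initial_interval[of _ m] standardise_initial_interval[of _ m]
        simp del: upt_Suc)
  moreover have "sorted_wrt (>) (rev [1..<Suc m])"
    unfolding sorted_wrt_rev by (rule sorted_wrt_upt)
  ultimately show ?thesis unfolding H_ID_def using sorted_wrt_upt by blast
qed

lemma subseq_rev:
  assumes "subseq xs ys"
  shows "subseq (rev xs) (rev ys)"
  using assms by induction (auto intro: list_emb_append_mono)

text \<open>
  Standardisation reflects strict monotonicity, so each half of a juxtaposition is a monotone list
  of values between 1 and \<open>m\<close>, hence a subsequence of the complete run in the same direction.
\<close>

lemma H_II_subseq:
  assumes "s \<in> H_II" "height s \<le> m"
  shows "subseq s ([1..<Suc m] @ [1..<Suc m])"
proof -
  obtain a b where ab: "sorted_wrt (<) a" "sorted_wrt (<) b" "horizontal_juxtaposition s a b"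
    using assms(1) by (auto simp: H_II_def)
  let ?x = "take (length a) s" and ?y = "drop (length a) s"
  have std: "standardise ?x = a" "standardise ?y = b" and "cayley s"
    using ab(3) unfolding horizontal_juxtaposition_def by blast+
  from set_cayley[OF \<open>cayley s\<close>] have set: "set s \<subseteq> set [1..<Suc m]" using assms(2) by auto
  have "sorted_wrt (<) ?x" "sorted_wrt (<) ?y"
    using ab(1,2) std sorted_standardiseD[of ?x] sorted_standardiseD[of ?y] by simp_all
  moreover have "set ?x \<subseteq> set [1..<Suc m]" "set ?y \<subseteq> set [1..<Suc m]"
    using set by (blast dest: in_set_takeD in_set_dropD)+
  ultimately have "subseq (?x @ ?y) ([1..<Suc m] @ [1..<Suc m])"
    by (intro list_emb_append_mono sorted_subset_imp_subseq sorted_upt)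
  then show ?thesis by simp
qed

lemma H_ID_subseq:
  assumes "s \<in> H_ID" "height s \<le> m"
  shows "subseq s ([1..<Suc m] @ rev [1..<Suc m])"
proof -
  obtain a b where ab: "sorted_wrt (<) a" "sorted_wrt (>) b" "horizontal_juxtaposition s a b"
    using assms(1) by (auto simp: H_ID_def)
  let ?x = "take (length a) s" and ?y = "drop (length a) s"
  have std: "standardise ?x = a" "standardise ?y = b" and "cayley s"
    using ab(3) unfolding horizontal_juxtaposition_def by blast+
  from set_cayley[OF \<open>cayley s\<close>] have set: "set s \<subseteq> set [1..<Suc m]" using assms(2) by auto
  have "sorted_wrt (<) ?x"
    using ab(1) std(1) sorted_standardiseD[of ?x] by simp
  moreover have "sorted_wrt (>) ?y"
    using ab(2) std(2) sorted_desc_standardiseD[of ?y] by simp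
  then have "sorted_wrt (<) (rev ?y)" by (simp add: sorted_wrt_rev)
  moreover have "set ?x \<subseteq> set [1..<Suc m]" "set (rev ?y) \<subseteq> set [1..<Suc m]"
    using set by (auto dest: in_set_takeD in_set_dropD simp del: upt_Suc)
  ultimately have x: "subseq ?x [1..<Suc m]" and y: "subseq (rev ?y) [1..<Suc m]"
    by (simp_all only: sorted_subset_imp_subseq sorted_upt)
  have "subseq (rev (rev ?y)) (rev [1..<Suc m])"
    using y by (rule subseq_rev)
  with x have "subseq (?x @ ?y) ([1..<Suc m] @ rev [1..<Suc m])"
    by (intro list_emb_append_mono) simp_all
  then show ?thesis by simp
qed

text \<open>
  Replacing each letter \<open>i\<close> by the \<open>i\<close>-th entry of an increasing list does not change the
  standardisation. The shift by one is due to values starting at 1 and list positions at 0. This is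
  used with \<open>ys\<close> one of the two double runs.
\<close>

lemma contains_relabelled:
  fixes l :: "nat list"
  assumes "cayley s" "subseq s ys" "set ys \<subseteq> {1..length l}"
    and "sorted_wrt (<) l" "subseq (map (\<lambda>i. l ! (i - 1)) ys) p"
  shows "contains p s"
proof -
  let ?f = "\<lambda>i. l ! (i - 1)"
  have "set s \<subseteq> {1..length l}"
    using assms(2,3) by (auto dest: list_emb_set)
  then have "strict_mono_on (set s) ?f"
    using assms(4)
    by (intro strict_mono_onI sorted_wrt_nth_less[of "(<)"]) (auto simp: less_diff_iff)
  then have "standardise (map ?f s) = standardise s"
    by (rule standardise_map_strict_mono)
  also have "\<dots> = s"
    using assms(1) by (rule standardise_initial_interval[OF set_cayley])
  finally have "standardise (map ?f s) = s" .
  moreover have "subseq (map ?f s) p"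
    using subseq_map[OF assms(2)] assms(5) by (rule subseq_order.trans)
  ultimately show ?thesis unfolding contains_def by blast
qed

lemma map_nth_pred_upt: "map (\<lambda>i. l ! (i - 1)) [1..<Suc (length l)] = l"
  by (rule nth_equalityI) (simp_all del: upt_Suc)

section \<open>Slots and shared values\<close>

lemma finite_repeating_slots: "finite (repeating_slots p t)"
  by (simp add: repeating_slots_def)

lemma finite_new_slots: "finite (new_slots p t)"
  by (simp add: new_slots_def)

text \<open>
  A repeating slot determines its value, since distinct values of the prefix have distinct ranks.
\<close>

lemma card_repeating_slots:
  "card (repeating_slots p t) = card (set (take t p) \<inter> set (drop t p))"
  unfolding repeating_slots_def
proof (rule card_image)
  have "inj_on (\<lambda>v. card {u \<in> set (take t p). u \<le> v}) (set (take t p) \<inter> set (drop t p))"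
    by (rule inj_on_subset[OF inj_on_card_le]) auto
  then show "inj_on (\<lambda>v. Repeating (card {u \<in> set (take t p). u \<le> v}))
      (set (take t p) \<inter> set (drop t p))"
    by (simp add: inj_on_def)
qed

lemma first_occurrence_nth:
  assumes "v \<in> set w"
  shows "first_occurrence w v < length w \<and> w ! first_occurrence w v = v"
proof -
  obtain i where "i < length w \<and> w ! i = v" using assms by (auto simp: in_set_conv_nth)
  then show ?thesis unfolding first_occurrence_def by (rule LeastI)
qed

lemma first_occurrence_less_iff:
  assumes "v \<in> set w"
  shows "first_occurrence w v < t \<longleftrightarrow> v \<in> set (take t w)"
proof
  assume "first_occurrence w v < t"
  then show "v \<in> set (take t w)"
    using first_occurrence_nth[OF assms] by (auto simp: in_set_conv_nth)
next
  assume "v \<in> set (take t w)"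
  then obtain i where i: "i < t" "i < length w \<and> w ! i = v" by (auto simp: in_set_conv_nth)
  from i(2) have "first_occurrence w v \<le> i" unfolding first_occurrence_def by (rule Least_le)
  with i(1) show "first_occurrence w v < t" by simp
qed

text \<open>
  A value that is still to come exceeds every value seen so far, as a larger one would have its
  first occurrence later. So every such value lies in the topmost gap.
\<close>

lemma card_new_slots_rgf:
  assumes "rgf p"
  shows "card (new_slots p t) \<le> 1"
proof -
  let ?A = "set (take t p)"
  have "i = card ?A" if "v \<in> gap (take t p) i" "v \<in> set (drop t p)" for i v
  proof -
    have v: "1 \<le> v" "v \<notin> ?A" "card {u \<in> ?A. u < v} = i"
      using that(1) by (auto simp: gap_def)
    have vp: "v \<in> set p" using that(2) by (rule in_set_dropD)
    have "u < v" if u: "u \<in> ?A" for u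
    proof (rule ccontr)
      assume "\<not> u < v"
      with u v(2) have "v < u" by (cases "u = v") auto
      have up: "u \<in> set p" using u by (rule in_set_takeD)
      have "first_occurrence p v < first_occurrence p u"
        using assms up v(1) \<open>v < u\<close> by (auto simp: rgf_def)
      also have "\<dots> < t" using u first_occurrence_less_iff[OF up] by simp
      finally show False using first_occurrence_less_iff[OF vp] v(2) by simp
    qed
    then have "{u \<in> ?A. u < v} = ?A" by blast
    with v(3) show ?thesis by simp
  qed
  then have "new_slots p t \<subseteq> {New (card ?A)}" by (auto simp: new_slots_def)
  from card_mono[OF _ this] show ?thesis by simp
qed

lemma SBM_H_iff:
  "p \<in> SBM_H k \<longleftrightarrow>
    matching_rgf p \<and> (\<forall>t\<le>length p. card (repeating_slots p t \<union> new_slots p t) \<le> k)"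
  unfolding SBM_H_def horizontal_evolution_def configuration_def
  by (auto simp: less_Suc_eq_le simp del: upt_Suc)

section \<open>Shared values against double runs\<close>

text \<open>
  An occurrence of the pattern \<open>xs @ ys\<close> splits at its middle. The two halves use the same values,
  since standardisation is injective on values, and each of these is shared at the split position.
\<close>

lemma contains_imp_many_shared_values:
  assumes "contains p (xs @ ys)" "set xs = set ys"
  obtains t where "t \<le> length p" "card (set xs) \<le> card (set (take t p) \<inter> set (drop t p))"
proof -
  obtain w where w: "subseq w p" "standardise w = xs @ ys"
    using assms(1) by (auto simp: contains_def)
  define r where "r = (\<lambda>x. card {y \<in> set w. y \<le> x})"
  have "map r w = xs @ ys" using w(2) by (simp only: standardise_def r_def)
  then obtain a b where ab: "w = a @ b" "map r a = xs" "map r b = ys"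
    by (auto simp: map_eq_append_conv)
  have inj: "inj_on r (set w)" unfolding r_def by (rule inj_on_card_le) simp
  have "r ` set a = r ` set b" using ab assms(2) by (metis set_map)
  then have eq: "set a = set b"
    using inj_on_image_eq_iff[OF inj, of "set a" "set b"] ab(1) by simp
  obtain p1 p2 where p: "p = p1 @ p2" "subseq a p1" "subseq b p2"
    using w(1) ab(1) by (auto dest: list_emb_appendD)
  have "set a \<subseteq> set p1 \<inter> set p2"
    using p eq by (auto dest: list_emb_set)
  then have "card (set a) \<le> card (set p1 \<inter> set p2)" by (intro card_mono) auto
  moreover have "card (set xs) \<le> card (set a)"
    using ab(2) card_image_le[of "set a" r] by auto
  ultimately show ?thesis using that[of "length p1"] p(1) by simp
qed

text \<open>
  To find a list of values in a word it suffices to choose a position for each value such that the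
  positions increase along the list.
\<close>

lemma subseq_by_positions:
  assumes "\<And>v. v \<in> set l \<Longrightarrow> pos v < length w \<and> w ! pos v = v"
    and "sorted_wrt (\<lambda>u v. pos u < pos v) l"
  shows "subseq l w"
proof -
  have "subseq (map pos l) [0..<length w]"
    using assms by (intro sorted_subset_imp_subseq) (auto simp: sorted_wrt_map)
  then have "subseq (map ((!) w) (map pos l)) (map ((!) w) [0..<length w])"
    by (rule subseq_map)
  moreover have "map ((!) w) (map pos l) = l"
    using assms(1) by (simp add: map_idI)
  ultimately show ?thesis by (simp add: map_nth)
qed

text \<open>
  Fix an occurrence in the suffix for each shared value, and colour two shared values by whether
  these occurrences come in increasing order of value. On a monochromatic set, which Ramsey's
  theorem provides, the suffix reads the values monotonically, and the prefix reads any set of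
  shared values in increasing order by first occurrences.
\<close>

lemma many_shared_values_imp_double_run:
  obtains r where
    "\<And>p t. \<lbrakk>rgf p; r \<le> card (set (take t p) \<inter> set (drop t p))\<rbrakk> \<Longrightarrow>
      \<exists>l. sorted_wrt (<) l \<and> length l = m \<and> (subseq (l @ l) p \<or> subseq (l @ rev l) p)"
proof -
  obtain r where r: "\<And>(V::nat set) E. finite V \<Longrightarrow> r \<le> card V \<Longrightarrow>
      \<exists>R\<subseteq>V. card R = m \<and> clique R E \<or> card R = m \<and> indep R E"
    using ramsey2[of m m, where ?'a = nat] by blast
  show ?thesis
  proof (rule that)
    fix p :: "nat list" and t
    let ?V = "set (take t p) \<inter> set (drop t p)"
    assume p: "rgf p" and large: "r \<le> card ?V"
    have "\<forall>v\<in>set (drop t p). \<exists>i<length (drop t p). drop t p ! i = v"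
      by (metis in_set_conv_nth)
    then obtain pos where pos:
      "\<And>v. v \<in> set (drop t p) \<Longrightarrow> pos v < length (drop t p) \<and> drop t p ! pos v = v"
      by metis
    define E where "E = {{u, v} | u v. u < v \<and> pos u < pos v}"
    obtain R where R: "R \<subseteq> ?V" "card R = m" "clique R E \<or> indep R E"
      using r[of ?V E] large by auto
    have "finite R" using R(1) by (rule finite_subset) simp
    define l where "l = sorted_list_of_set R"
    have l: "set l = R" "sorted_wrt (<) l" "length l = m"
      using \<open>finite R\<close> R(2) by (simp_all add: l_def)
    have "subseq l (take t p)"
    proof (rule subseq_by_positions)
      fix v assume "v \<in> set l"
      then have v: "v \<in> set (take t p)" using l R by blast
      then have "v \<in> set p" by (rule in_set_takeD)
      then show "first_occurrence p v < length (take t p) \<and> take t p ! first_occurrence p v = v"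
        using first_occurrence_nth first_occurrence_less_iff[of v p t] v by simp
    next
      have "first_occurrence p u < first_occurrence p v"
        if "u \<in> set l" "v \<in> set l" "u < v" for u v
      proof -
        have "u \<in> set (take t p)" "v \<in> set (take t p)" using that(1,2) l(1) R(1) by auto
        then have "u \<in> set p" "v \<in> set p" by - (rule in_set_takeD, assumption)+
        moreover from this have "1 \<le> u" using p unfolding rgf_def cayley_def by blast
        ultimately show ?thesis using p \<open>u < v\<close> by (auto simp: rgf_def)
      qed
      then show "sorted_wrt (\<lambda>u v. first_occurrence p u < first_occurrence p v) l"
        using l(2) by (rule sorted_wrt_mono_rel)
    qed
    moreover have "subseq l (drop t p) \<or> subseq (rev l) (drop t p)"
      using R(3)
    proof
      assume R': "clique R E"
      have "pos u < pos v" if "u \<in> set l" "v \<in> set l" "u < v" for u v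
      proof -
        have "{u, v} \<in> E" using R' that l(1) by (auto simp: clique_def)
        then show ?thesis using \<open>u < v\<close> by (auto simp: E_def doubleton_eq_iff)
      qed
      then have "sorted_wrt (\<lambda>u v. pos u < pos v) l"
        using l(2) by (rule sorted_wrt_mono_rel)
      then have "subseq l (drop t p)"
        using l(1) R(1) by (intro subseq_by_positions[OF pos]) auto
      then show ?thesis ..
    next
      assume R': "indep R E"
      have "pos v < pos u" if uv: "u \<in> set l" "v \<in> set l" "u < v" for u v
      proof -
        have "{u, v} \<notin> E" using R' uv l(1) by (auto simp: indep_def)
        then have "pos v \<le> pos u" using \<open>u < v\<close> by (force simp: E_def)
        moreover have "pos u \<noteq> pos v"
        proof -
          have "u \<in> set (drop t p)" "v \<in> set (drop t p)" using uv(1,2) l(1) R(1) by auto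
          then have "drop t p ! pos u = u" "drop t p ! pos v = v" by (simp_all only: pos)
          then show ?thesis using uv(3) by (metis less_irrefl)
        qed
        ultimately show ?thesis by simp
      qed
      then have "sorted_wrt (\<lambda>u v. pos v < pos u) l"
        using l(2) by (rule sorted_wrt_mono_rel)
      then have "sorted_wrt (\<lambda>u v. pos u < pos v) (rev l)"
        by (simp add: sorted_wrt_rev)
      then have "subseq (rev l) (drop t p)"
        using l(1) R(1) by (intro subseq_by_positions[OF pos]) auto
      then show ?thesis ..
    qed
    ultimately have "subseq (l @ l) (take t p @ drop t p) \<or>
        subseq (l @ rev l) (take t p @ drop t p)"
      by (blast intro: list_emb_append_mono)
    with l show "\<exists>l. sorted_wrt (<) l \<and> length l = m \<and>
        (subseq (l @ l) p \<or> subseq (l @ rev l) p)"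
      by auto
  qed
qed

section \<open>The characterisation\<close>

theorem corollary2p6:
  fixes Pats :: "nat list set"
  assumes "\<forall>s\<in>Pats. cayley s"
  shows "(\<exists>k::nat. 0 < k \<and> matching_class Pats \<subseteq> SBM_H k) \<longleftrightarrow>
    (\<exists>s\<in>H_II. \<exists>t\<in>H_ID. \<forall>p\<in>matching_class Pats. avoids p s \<and> avoids p t)"
proof
  assume "\<exists>k::nat. 0 < k \<and> matching_class Pats \<subseteq> SBM_H k"
  then obtain k where k: "matching_class Pats \<subseteq> SBM_H k" by blast
  \<comment> \<open>A double run on \<open>k + 1\<close> values forces \<open>k + 1\<close> repeating slots.\<close>
  let ?x = "[1..<Suc (Suc k)]"
  have avoid: "avoids p (?x @ ys)" if p: "p \<in> matching_class Pats" and ys: "set ys = set ?x" for p ys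
    unfolding avoids_def
  proof
    assume "contains p (?x @ ys)"
    then obtain t where t: "t \<le> length p"
        "card (set ?x) \<le> card (set (take t p) \<inter> set (drop t p))"
      using ys by (auto elim: contains_imp_many_shared_values simp del: upt_Suc)
    then have "Suc k \<le> card (repeating_slots p t)"
      by (simp add: card_repeating_slots del: upt_Suc)
    also have "\<dots> \<le> card (repeating_slots p t \<union> new_slots p t)"
      by (intro card_mono) (auto simp: finite_repeating_slots finite_new_slots)
    also have "\<dots> \<le> k" using k p t(1) by (auto simp: SBM_H_iff)
    finally show False by simp
  qed
  have "\<forall>p\<in>matching_class Pats. avoids p (?x @ ?x) \<and> avoids p (?x @ rev ?x)"
    using avoid by (simp del: upt_Suc)
  then show "\<exists>s\<in>H_II. \<exists>t\<in>H_ID. \<forall>p\<in>matching_class Pats. avoids p s \<and> avoids p t"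
    using H_II_double_run H_ID_double_run by blast
next
  assume "\<exists>s\<in>H_II. \<exists>t\<in>H_ID. \<forall>p\<in>matching_class Pats. avoids p s \<and> avoids p t"
  then obtain s t where st: "s \<in> H_II" "t \<in> H_ID"
      "\<And>p. p \<in> matching_class Pats \<Longrightarrow> avoids p s \<and> avoids p t"
    by blast
  have cayley: "cayley s" "cayley t"
    using st(1,2) by (auto simp: H_II_def H_ID_def horizontal_juxtaposition_def)
  \<comment> \<open>Whichever double run is found, it must be long enough for the pattern of its class.\<close>
  let ?m = "max (height s) (height t)"
  obtain r where r: "\<And>p i. \<lbrakk>rgf p; r \<le> card (set (take i p) \<inter> set (drop i p))\<rbrakk> \<Longrightarrow>
      \<exists>l. sorted_wrt (<) l \<and> length l = ?m \<and> (subseq (l @ l) p \<or> subseq (l @ rev l) p)"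
    using many_shared_values_imp_double_run[of ?m] by blast
  have few_shared: "card (set (take i p) \<inter> set (drop i p)) < r"
    if p: "p \<in> matching_class Pats" for p i
  proof (rule ccontr)
    assume "\<not> card (set (take i p) \<inter> set (drop i p)) < r"
    moreover have "rgf p" using p by (simp add: matching_class_def matching_rgf_def)
    ultimately obtain l where l: "sorted_wrt (<) l" "length l = ?m"
        and double: "subseq (l @ l) p \<or> subseq (l @ rev l) p"
      using r by (meson not_less)
    let ?f = "\<lambda>i. l ! (i - 1)" and ?x = "[1..<Suc ?m]"
    have map: "map ?f ?x = l" using map_nth_pred_upt[of l] l(2) by simp
    have set: "set (?x @ ?x) \<subseteq> {1..length l}" "set (?x @ rev ?x) \<subseteq> {1..length l}"
      using l(2) by auto
    from double show False
    proof
      assume "subseq (l @ l) p"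
      then have "subseq (map ?f (?x @ ?x)) p" by (simp only: map_append map)
      then have "contains p s"
        by (rule contains_relabelled[OF cayley(1) H_II_subseq[OF st(1)] set(1) l(1), rotated]) simp
      then show False using st(3)[OF p] by (simp add: avoids_def)
    next
      assume "subseq (l @ rev l) p"
      then have "subseq (map ?f (?x @ rev ?x)) p" by (simp only: map_append rev_map[symmetric] map)
      then have "contains p t"
        by (rule contains_relabelled[OF cayley(2) H_ID_subseq[OF st(2)] set(2) l(1), rotated]) simp
      then show False using st(3)[OF p] by (simp add: avoids_def)
    qed
  qed
  have "card (repeating_slots p i \<union> new_slots p i) \<le> Suc r"
    if p: "p \<in> matching_class Pats" for p i
  proof -
    have "card (repeating_slots p i \<union> new_slots p i)
        \<le> card (repeating_slots p i) + card (new_slots p i)"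
      by (rule card_Un_le)
    also have "\<dots> \<le> r + 1"
      using few_shared[OF p, of i] p card_new_slots_rgf[of p i]
      by (intro add_mono) (auto simp: card_repeating_slots matching_class_def matching_rgf_def)
    finally show ?thesis by simp
  qed
  then have "matching_class Pats \<subseteq> SBM_H (Suc r)"
    by (auto simp: SBM_H_iff) (simp add: matching_class_def)
  then show "\<exists>k::nat. 0 < k \<and> matching_class Pats \<subseteq> SBM_H k" by blast
qed

end
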